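(* Let $m\ge 1$ be an integer and let $(f_n)_n$ be a sequence of functions in $\mathbb F_m$. Assume that $f_n$ converges uniformly on $[0,1]$ towards a function $f$ which is not identically $0$. Then $f\in\mathbb F_m$.
   Context: All trees are infinite, locally finite and rooted; $o$ denotes the root, $|\nu|$ the distance from $\nu$ to the root, $\deg\nu$ the number of neighbours of $\nu$. A tree is spherically symmetric if $\deg\nu$ depends only on $|\nu|$. $A_m$ is the set of spherically symmetric trees $\mathcal T$ such that $\deg\nu\le m$ for every vertex $\nu$. For $\lambda>0$, $RW_\lambda$ is the Markov chain on the vertices of $\mathcal T$ which, at a vertex $x\ne o$ with $k$ children, jumps to the parent of $x$ with probability $1/(1+k\lambda)$ and to each child with probability $\lambda/(1+k\lambda)$; from $o$ it jumps to a uniformly chosen child. The effective conductance $\mathcal C(\lambda,\mathcal T)$ is that of the network in which each edge $(x,y)$, with $x$ the parent of $y$, has conductance $\lambda^{|x|}$; that is, $\mathcal C(\lambda,\mathcal T)=\pi(o)\,\mathbb P(RW_\lambda\text{ started at }o\text{ never returns to }o)$, with $\pi(o)$ the sum of conductances of edges at the root (the number of children of $o$). $\mathbb F_m$ is the set of continuous functions $f:[0,1]\to\mathbb R$ for which there exists $\mathcal T\in A_m$ such that $f(\lambda)=\mathcal C(\lambda,\mathcal T)$ for all $\lambda\in(0,1]$. *)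

theory Defs
  imports "HOL-Probability.Probability"
begin

text \<open>
  Rooted trees are in Ulam--Harris form: a vertex is a finite list of labels, the root is \<open>[]\<close>, the
  parent of \<open>x \<noteq> []\<close> is \<open>butlast x\<close>, and a tree is a set of vertices closed under taking parents.
  Hence the distance of \<open>x\<close> to the root is \<open>length x\<close>. The labels of the children of a vertex may be
  arbitrary natural numbers. Up to isomorphism every locally finite rooted tree is of this form,
  and everything below is invariant under isomorphism of rooted trees.
\<close>

type_synonym vertex = "nat list"

definition children :: "vertex set \<Rightarrow> vertex \<Rightarrow> vertex set" where
  "children T x = {y \<in> T. y \<noteq> [] \<and> butlast y = x}"

definition neighbours :: "vertex set \<Rightarrow> vertex \<Rightarrow> vertex set" where
  "neighbours T x = {y \<in> T. y \<in> children T x \<or> x \<in> children T y}"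

definition deg :: "vertex set \<Rightarrow> vertex \<Rightarrow> nat" where
  "deg T x = card (neighbours T x)"

definition rooted_tree :: "vertex set \<Rightarrow> bool" where
  "rooted_tree T \<longleftrightarrow>
     [] \<in> T \<and> (\<forall>x\<in>T. x \<noteq> [] \<longrightarrow> butlast x \<in> T) \<and>
     infinite T \<and> (\<forall>x\<in>T. finite (neighbours T x))"

definition spherically_symmetric :: "vertex set \<Rightarrow> bool" where
  "spherically_symmetric T \<longleftrightarrow> (\<forall>x\<in>T. \<forall>y\<in>T. length x = length y \<longrightarrow> deg T x = deg T y)"

definition A_trees :: "nat \<Rightarrow> vertex set set" where
  "A_trees m = {T. rooted_tree T \<and> spherically_symmetric T \<and> (\<forall>x\<in>T. deg T x \<le> m)}"

definition transition_prob :: "vertex set \<Rightarrow> real \<Rightarrow> vertex \<Rightarrow> vertex \<Rightarrow> real" where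
  "transition_prob T lam x y =
     (let k = real (card (children T x)) in
      if x = [] then (if y \<in> children T x then 1 / k else 0)
      else if y = butlast x then 1 / (1 + k * lam)
      else if y \<in> children T x then lam / (1 + k * lam)
      else 0)"

definition RW_step :: "vertex set \<Rightarrow> real \<Rightarrow> vertex \<Rightarrow> vertex pmf" where
  "RW_step T lam x = embed_pmf (transition_prob T lam x)"

lemma finite_children:
  assumes "rooted_tree T" "x \<in> T"
  shows "finite (children T x)"
proof -
  have "children T x \<subseteq> neighbours T x"
    by (auto simp: children_def neighbours_def)
  with assms show ?thesis
    unfolding rooted_tree_def by (meson finite_subset)
qed

lemma children_root_nonempty:
  assumes "rooted_tree T"
  shows "children T [] \<noteq> {}"
proof
  assume *: "children T [] = {}"
  have "x = []" if "x \<in> T" for x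
    using that
  proof (induction x rule: rev_induct)
    case (snoc a x)
    then have "x \<in> T"
      using assms unfolding rooted_tree_def by force
    with snoc have "[a] \<in> T" by simp
    then have "[a] \<in> children T []" by (simp add: children_def)
    with * show ?case by simp
  qed simp
  then have "T \<subseteq> {[]}" by auto
  then have "finite T" by (rule finite_subset) simp
  with assms show False by (simp add: rooted_tree_def)
qed

text \<open>The transition probabilities sum to 1, so \<^const>\<open>RW_step\<close> has them as its mass function.\<close>

lemma pmf_RW_step:
  assumes T: "rooted_tree T" "x \<in> T" and lam: "lam > 0"
  shows "pmf (RW_step T lam x) y = transition_prob T lam x y"
proof -
  let ?p = "transition_prob T lam x" and ?C = "children T x"
  let ?S = "if x = [] then ?C else insert (butlast x) ?C"
  define k where "k = real (card ?C)"
  have fin: "finite ?C" using T by (rule finite_children)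
  have nonneg: "0 \<le> ?p z" for z
    using lam by (simp add: transition_prob_def Let_def)
  have k0: "k \<ge> 0" by (simp add: k_def)
  have "sum ?p ?S = 1"
  proof (cases "x = []")
    case True
    with children_root_nonempty[OF T(1)] fin show ?thesis
      by (simp add: transition_prob_def)
  next
    case False
    have ni: "butlast x \<notin> ?C"
    proof
      assume "butlast x \<in> ?C"
      then have "butlast (butlast x) = x" by (simp add: children_def)
      then have "length x - 1 - 1 = length x" by (metis length_butlast)
      with False show False by (cases x) auto
    qed
    have "sum ?p ?C = (\<Sum>z\<in>?C. lam / (1 + k * lam))"
      using False ni by (intro sum.cong) (auto simp: transition_prob_def k_def Let_def)
    then have "sum ?p ?S = 1 / (1 + k * lam) + k * (lam / (1 + k * lam))"
      using False ni fin by (simp add: transition_prob_def k_def)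
    also have "\<dots> = 1"
      using lam k0 by (simp add: add_divide_distrib[symmetric] add_nonneg_eq_0_iff)
    finally show ?thesis .
  qed
  moreover have "(\<integral>\<^sup>+z. ennreal (?p z) \<partial>count_space UNIV) = (\<Sum>z\<in>?S. ennreal (?p z))"
    using fin by (intro nn_integral_count_space'[of ?S])
       (auto simp: transition_prob_def Let_def split: if_splits)
  ultimately have "(\<integral>\<^sup>+z. ennreal (?p z) \<partial>count_space UNIV) = 1"
    using nonneg by (simp add: sum_ennreal del: sum.insert)
  then show ?thesis
    unfolding RW_step_def using nonneg by (intro pmf_embed_pmf) auto
qed

definition RW_kernel :: "vertex set \<Rightarrow> real \<Rightarrow> nat \<Rightarrow> (nat \<Rightarrow> vertex) \<Rightarrow> vertex measure" where
  "RW_kernel T lam n \<omega> =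
     measure_pmf (if n = 0 then return_pmf [] else RW_step T lam (\<omega> (n - 1)))"

lemma Ionescu_Tulcea_RW_kernel: "Ionescu_Tulcea (RW_kernel T lam) (\<lambda>_. count_space UNIV)"
proof (rule Ionescu_Tulcea.intro)
  fix n
  let ?N = "PiM {0..<n} (\<lambda>_. count_space UNIV) :: (nat \<Rightarrow> vertex) measure"
  show "RW_kernel T lam n \<in> measurable ?N (subprob_algebra (count_space UNIV))"
  proof (cases n)
    case 0
    then show ?thesis
      by (auto simp: RW_kernel_def[abs_def] measure_pmf_in_subprob_algebra intro!: measurable_const)
  next
    case (Suc i)
    have "(\<lambda>\<omega>. \<omega> i) \<in> measurable ?N (count_space UNIV)"
      using Suc by (intro measurable_component_singleton) simp
    moreover have "(\<lambda>x. measure_pmf (RW_step T lam x))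
        \<in> measurable (count_space UNIV) (subprob_algebra (count_space UNIV))"
      by (simp add: measure_pmf_in_subprob_algebra)
    ultimately have "(\<lambda>\<omega>. measure_pmf (RW_step T lam (\<omega> i)))
        \<in> measurable ?N (subprob_algebra (count_space UNIV))"
      by (rule measurable_compose)
    then show ?thesis
      by (simp add: RW_kernel_def[abs_def] Suc)
  qed
next
  fix n and x :: "nat \<Rightarrow> vertex"
  show "prob_space (RW_kernel T lam n x)"
    unfolding RW_kernel_def by (rule prob_space_measure_pmf)
qed

text \<open>
  The law of the trajectory \<open>(X\<^sub>n)\<close> of the walk started at the root, as a measure on the sequences of
  vertices: the Ionescu-Tulcea measure of the kernels above, where the law of \<open>X\<^sub>n\<close> given
  \<open>X\<^sub>0, \<dots>, X\<^bsub>n-1\<^esub>\<close> is \<open>RW_step T lam X\<^bsub>n-1\<^esub>\<close> for \<open>n > 0\<close>.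
\<close>

definition RW :: "vertex set \<Rightarrow> real \<Rightarrow> (nat \<Rightarrow> vertex) measure" where
  "RW T lam = projective_family.lim UNIV
     (Ionescu_Tulcea.CI (RW_kernel T lam) (\<lambda>_. count_space UNIV)) (\<lambda>_. count_space UNIV)"

lemma distr_RW:
  assumes "finite J"
  shows "distr (RW T lam) (PiM J (\<lambda>_. count_space UNIV)) (\<lambda>\<omega>. restrict \<omega> J) =
    Ionescu_Tulcea.CI (RW_kernel T lam) (\<lambda>_. count_space UNIV) J"
  unfolding RW_def by (rule Ionescu_Tulcea.distr_lim[OF Ionescu_Tulcea_RW_kernel assms])

text \<open>For an edge \<open>{x, y}\<close>, \<open>min (length x) (length y)\<close> is the depth of the endpoint that is the parent.\<close>

definition conductance :: "real \<Rightarrow> vertex \<Rightarrow> vertex \<Rightarrow> real" where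
  "conductance lam x y = lam ^ min (length x) (length y)"

definition total_conductance :: "vertex set \<Rightarrow> real \<Rightarrow> vertex \<Rightarrow> real" where
  "total_conductance T lam x = (\<Sum>y\<in>neighbours T x. conductance lam x y)"

definition effective_conductance :: "real \<Rightarrow> vertex set \<Rightarrow> real" where
  "effective_conductance lam T =
     total_conductance T lam [] *
     measure (RW T lam) {\<omega> \<in> space (RW T lam). \<forall>n>0. \<omega> n \<noteq> []}"

text \<open>
  A function on \<open>[0,1]\<close> is represented by a function on the reals of which only the values on
  \<open>[0,1]\<close> are constrained.
\<close>

definition F_functions :: "nat \<Rightarrow> (real \<Rightarrow> real) set" where
  "F_functions m = {f. continuous_on {0..1} f \<and>
             (\<exists>T\<in>A_trees m. \<forall>lam\<in>{0<..1}. f lam = effective_conductance lam T)}"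

end

theory Submission
  imports Defs
begin

text \<open>
  If \<open>k i\<close> is the number of children of a vertex at depth \<open>i\<close>, merging the vertices of each level
  turns the tree into a series of resistors of resistances \<open>r j = 1 / (lam ^ j * (k 0 * \<dots> * k j))\<close>,
  so \<open>C(lam) = 1 / (\<Sum>j. r j)\<close>, read as \<open>0\<close> when the series diverges. On the probabilistic side, the
  probability \<open>w d\<close> of never hitting the root from depth \<open>d\<close> is the largest solution, among those
  bounded by 1 and vanishing at \<open>0\<close>, of the harmonic equation; its solutions are the multiples of
  \<open>\<Sum>j<d. r j\<close>.

  The sequences \<open>k\<close> of trees in \<open>A\<^sub>m\<close> form a compact set, so along a subsequence they converge
  pointwise to some \<open>l\<close>. If \<open>g lam0 > 0\<close>, then the resistances at \<open>lam0\<close> are eventually bounded, hence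
  at every \<open>lam > lam0\<close> they are dominated by a geometric series, and \<open>g lam\<close> is the conductance of \<open>l\<close>.
  Let \<open>s\<close> be the infimum of the points where \<open>g > 0\<close>. Below \<open>s\<close> Fatou only gives
  \<open>g \<le> C(\<cdot>, l)\<close>; but the conductance of \<open>l\<close> is monotone and equals \<open>g\<close> above \<open>s\<close>, so continuity of
  \<open>g\<close> at \<open>s\<close> and \<open>g s = 0\<close> force it to vanish on \<open>(0, s]\<close>. That \<open>g\<close> is not identically \<open>0\<close>
  guarantees \<open>s < 1\<close>.
\<close>

section \<open>The law of the walk\<close>

text \<open>\<open>avoid_prob T lam n x\<close> is the probability that the walk from \<open>x\<close> is not at the root at any of the times \<open>0, \<dots>, n\<close>.\<close>

primrec avoid_prob :: "vertex set \<Rightarrow> real \<Rightarrow> nat \<Rightarrow> vertex \<Rightarrow> ennreal" where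
  "avoid_prob T lam 0 x = of_bool (x \<noteq> [])"
| "avoid_prob T lam (Suc n) x =
     (if x = [] then 0 else \<integral>\<^sup>+y. avoid_prob T lam n y \<partial>measure_pmf (RW_step T lam x))"

lemma sets_RW [measurable_cong]: "sets (RW T lam) = sets (PiM UNIV (\<lambda>_. count_space UNIV))"
proof -
  interpret Ionescu_Tulcea "RW_kernel T lam" "\<lambda>_. count_space UNIV :: vertex measure"
    by (rule Ionescu_Tulcea_RW_kernel)
  show ?thesis unfolding RW_def by (rule PF.sets_lim)
qed

lemma space_RW: "space (RW T lam) = UNIV"
  using sets_eq_imp_space_eq[OF sets_RW] by (simp add: space_PiM)

text \<open>Projections to finitely many coordinates preserve total mass, so the empty set of
  coordinates is enough.\<close>

lemma prob_space_RW: "prob_space (RW T lam)"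
proof -
  interpret Ionescu_Tulcea "RW_kernel T lam" "\<lambda>_. count_space UNIV :: vertex measure"
    by (rule Ionescu_Tulcea_RW_kernel)
  show ?thesis
  proof (rule prob_space_distrD)
    show "(\<lambda>\<omega>. restrict \<omega> {}) \<in> measurable (RW T lam) (PiM {} (\<lambda>_. count_space UNIV))"
      by (simp add: measurable_cong_sets[OF sets_RW refl] measurable_restrict_subset)
    show "prob_space (distr (RW T lam) (PiM {} (\<lambda>_. count_space UNIV)) (\<lambda>\<omega>. restrict \<omega> {}))"
      by (subst distr_RW) (simp_all add: PF.prob_space_P)
  qed
qed

text \<open>The event depends on the coordinates \<open>0, ..., n + 1\<close> only, so it can be
  integrated against the finite product of kernels. Integrating out the last coordinate again and
  again trades one time step of the path for one step of \<open>avoid_prob\<close>.\<close>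

lemma emeasure_RW_avoid:
  "emeasure (RW T lam) {\<omega>. \<forall>i\<in>{0<..Suc n}. \<omega> i \<noteq> []} =
     (\<integral>\<^sup>+y. avoid_prob T lam n y \<partial>measure_pmf (RW_step T lam []))"
proof -
  let ?M = "\<lambda>_::nat. count_space UNIV :: vertex measure"
  interpret Ionescu_Tulcea "RW_kernel T lam" ?M
    by (rule Ionescu_Tulcea_RW_kernel)
  let ?u = "\<lambda>_::nat. undefined :: vertex"
  have u: "?u \<in> space (PiM {0..<0} ?M)" by simp
  \<comment> \<open>Time 0 is left out because the walk starts at the root; hence \<open>F 0\<close>
    is constantly 1.\<close>
  define F where "F j (\<omega>::nat \<Rightarrow> vertex) = (of_bool (\<forall>i\<in>{0<..j}. \<omega> i \<noteq> []) :: ennreal)" for j \<omega>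
  have F_meas [measurable]: "F j \<in> borel_measurable (PiM {0..<Suc k} ?M)" if "j \<le> k" for j k
  proof -
    have [measurable]: "(\<lambda>\<omega>. \<omega> i) \<in> measurable (PiM {0..<Suc k} ?M) (count_space UNIV)" if "i \<in> {0<..j}" for i
      using that \<open>j \<le> k\<close> by (intro measurable_component_singleton) auto
    have "Measurable.pred (PiM {0..<Suc k} ?M) (\<lambda>\<omega>. \<forall>i\<in>{0<..j}. \<omega> i \<noteq> [])"
      by (intro pred_intros_finite) auto
    then show ?thesis unfolding F_def by measurable
  qed
  have step: "(\<integral>\<^sup>+\<omega>. F (Suc j) \<omega> * avoid_prob T lam n (\<omega> (Suc j)) \<partial>C 0 (Suc (Suc j)) ?u) =
     (\<integral>\<^sup>+\<omega>. F j \<omega> * (\<integral>\<^sup>+y. avoid_prob T lam n y \<partial>measure_pmf (RW_step T lam (\<omega> j))) \<partial>C 0 (Suc j) ?u)" for j n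
  proof -
    \<comment> \<open>The condition on the last coordinate is absorbed, since
      \<open>avoid_prob\<close> already vanishes at the root.\<close>
    have az: "of_bool (y \<noteq> []) * avoid_prob T lam n y = avoid_prob T lam n y" for y
      by (cases n) auto
    have [measurable]: "(\<lambda>\<omega>. \<omega> (Suc j)) \<in> measurable (PiM {0..<Suc (Suc j)} ?M) (count_space UNIV)"
      by (intro measurable_component_singleton) auto
    have G: "(\<lambda>\<omega>. F (Suc j) \<omega> * avoid_prob T lam n (\<omega> (Suc j))) \<in> borel_measurable (PiM {0..<Suc (Suc j)} ?M)"
      by measurable auto
    have "(\<integral>\<^sup>+\<omega>. F (Suc j) \<omega> * avoid_prob T lam n (\<omega> (Suc j)) \<partial>C 0 (Suc (Suc j)) ?u) =
       (\<integral>\<^sup>+\<omega>. \<integral>\<^sup>+\<omega>'. F (Suc j) \<omega>' * avoid_prob T lam n (\<omega>' (Suc j)) \<partial>eP (Suc j) \<omega> \<partial>C 0 (Suc j) ?u)"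
      using measurable_eP[of "Suc j"] G
      by (subst C.simps(2), subst nn_integral_bind[where B="PiM {0..<Suc (Suc j)} ?M"])
         (auto simp: measurable_cong_sets[OF sets_C[OF u] refl] simp del: C.simps)
    also have "\<dots> = (\<integral>\<^sup>+\<omega>. F j \<omega> * (\<integral>\<^sup>+y. avoid_prob T lam n y \<partial>measure_pmf (RW_step T lam (\<omega> j))) \<partial>C 0 (Suc j) ?u)"
    proof (rule nn_integral_cong)
      fix \<omega> assume "\<omega> \<in> space (C 0 (Suc j) ?u)"
      then have w: "\<omega> \<in> space (PiM {0..<Suc j} ?M)" by (simp add: space_C[OF u] del: C.simps)
      have ins: "{0<..Suc j} = insert (Suc j) {0<..j}" by auto
      have F: "F (Suc j) (fun_upd \<omega> (Suc j) y) = F j \<omega> * of_bool (y \<noteq> [])" for y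
        by (simp add: F_def of_bool_def ins)
      show "(\<integral>\<^sup>+\<omega>'. F (Suc j) \<omega>' * avoid_prob T lam n (\<omega>' (Suc j)) \<partial>eP (Suc j) \<omega>) =
          F j \<omega> * (\<integral>\<^sup>+y. avoid_prob T lam n y \<partial>measure_pmf (RW_step T lam (\<omega> j)))"
        by (subst nn_integral_eP[OF w G])
           (simp add: F RW_kernel_def mult.assoc az nn_integral_cmult)
    qed
    finally show ?thesis .
  qed
  \<comment> \<open>\<open>F (Suc j)\<close> forces position \<open>Suc j\<close> off the root,
    where the inner integral left by \<open>step\<close> is the next \<open>avoid_prob\<close>. The
    peeling stops at time 1: at time 0 the walk is at the root, where \<open>avoid_prob\<close>
    would give 0.\<close>
  have shift: "(\<integral>\<^sup>+\<omega>. F (Suc j) \<omega> * avoid_prob T lam n (\<omega> (Suc j)) \<partial>C 0 (Suc (Suc j)) ?u) =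
     (\<integral>\<^sup>+\<omega>. F 1 \<omega> * avoid_prob T lam (n + j) (\<omega> 1) \<partial>C 0 2 ?u)" for j n
  proof (induction j arbitrary: n)
    case 0
    then show ?case by (simp add: numeral_2_eq_2)
  next
    case (Suc j)
    have "F (Suc j) \<omega> * (\<integral>\<^sup>+y. avoid_prob T lam n y \<partial>measure_pmf (RW_step T lam (\<omega> (Suc j)))) =
      F (Suc j) \<omega> * avoid_prob T lam (Suc n) (\<omega> (Suc j))" for \<omega>
      by (auto simp: F_def of_bool_def)
    then show ?case
      unfolding step[of "Suc j" n] by (simp add: Suc.IH del: C.simps avoid_prob.simps)
  qed
  have "(\<integral>\<^sup>+\<omega>. F 1 \<omega> * avoid_prob T lam n (\<omega> 1) \<partial>C 0 2 ?u) =
     (\<integral>\<^sup>+\<omega>. (\<integral>\<^sup>+y. avoid_prob T lam n y \<partial>measure_pmf (RW_step T lam (\<omega> 0))) \<partial>C 0 1 ?u)"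
    using step[of 0 n] by (simp add: F_def numeral_2_eq_2 del: C.simps)
  also have "\<dots> = (\<integral>\<^sup>+y. avoid_prob T lam n y \<partial>measure_pmf (RW_step T lam []))"
  proof -
    have [measurable]: "(\<lambda>\<omega>. \<omega> 0) \<in> measurable (PiM {0..<Suc 0} ?M) (count_space UNIV)"
      by (intro measurable_component_singleton) auto
    have G: "(\<lambda>\<omega>. \<integral>\<^sup>+y. avoid_prob T lam n y \<partial>measure_pmf (RW_step T lam (\<omega> 0)))
        \<in> borel_measurable (PiM {0..<Suc 0} ?M)"
      by measurable
    have "C 0 1 ?u = eP 0 ?u"
      using bind_return[OF measurable_eP[of 0] u] by simp
    then show ?thesis
      by (simp add: nn_integral_eP[OF u G] RW_kernel_def nn_integral_return)
  qed
  finally have base: "(\<integral>\<^sup>+\<omega>. F 1 \<omega> * avoid_prob T lam n (\<omega> 1) \<partial>C 0 2 ?u) = \<dots>" .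
  let ?J = "{0..<Suc (Suc n)}"
  let ?X = "{\<omega> \<in> space (PiM ?J ?M). \<forall>i\<in>{0<..Suc n}. \<omega> i \<noteq> []}"
  have X: "?X \<in> sets (PiM ?J ?M)"
  proof -
    have [measurable]: "(\<lambda>\<omega>. \<omega> i) \<in> measurable (PiM ?J ?M) (count_space UNIV)" if "i \<in> {0<..Suc n}" for i
      using that by (intro measurable_component_singleton) auto
    show ?thesis
      by (intro predE pred_intros_finite) auto
  qed
  have "{\<omega>. \<forall>i\<in>{0<..Suc n}. \<omega> i \<noteq> []} = PF.emb UNIV ?J ?X"
    by (auto simp: prod_emb_def space_PiM restrict_def)
  then have "emeasure (RW T lam) {\<omega>. \<forall>i\<in>{0<..Suc n}. \<omega> i \<noteq> []} = emeasure (CI ?J) ?X"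
    unfolding RW_def by (simp only: lim[OF finite_atLeastLessThan X])
  also have "\<dots> = emeasure (C 0 (Suc (Suc n)) ?u) ?X"
    using X sets.sets_into_space[OF X]
    by (subst emeasure_CI[OF subset_refl X]) (simp add: prod_emb_id space_PiM del: C.simps)
  also have "\<dots> = (\<integral>\<^sup>+\<omega>. indicator ?X \<omega> \<partial>C 0 (Suc (Suc n)) ?u)"
    using X by (subst nn_integral_indicator) (simp_all add: sets_C[OF u] del: C.simps)
  also have "\<dots> = (\<integral>\<^sup>+\<omega>. F (Suc n) \<omega> * avoid_prob T lam 0 (\<omega> (Suc n)) \<partial>C 0 (Suc (Suc n)) ?u)"
    by (intro nn_integral_cong) (auto simp: space_C[OF u] F_def indicator_def simp del: C.simps)
  finally show ?thesis
    by (simp only: shift add_0_left base)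
qed

section \<open>Escape from the origin for the depth process\<close>

text \<open>From depth \<open>j\<close> to depth \<open>j + 1\<close> there are
  \<open>k 0 * ... * k j\<close> parallel edges of conductance \<open>lam ^ j\<close>; this is the
  resistance of the merged edge.\<close>

definition level_resistance :: "(nat \<Rightarrow> nat) \<Rightarrow> real \<Rightarrow> nat \<Rightarrow> real" where
  "level_resistance k lam j = 1 / (lam ^ j * (\<Prod>i\<le>j. real (k i)))"

definition series_conductance :: "(nat \<Rightarrow> nat) \<Rightarrow> real \<Rightarrow> real" where
  "series_conductance k lam =
     (if summable (level_resistance k lam) then 1 / suminf (level_resistance k lam) else 0)"

text \<open>The analogue of \<open>avoid_prob\<close> for the depth of the walk, a birth-and-death
  chain on the naturals.\<close>

primrec avoid_depth :: "(nat \<Rightarrow> nat) \<Rightarrow> real \<Rightarrow> nat \<Rightarrow> nat \<Rightarrow> real" where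
  "avoid_depth k lam 0 d = of_bool (d \<noteq> 0)"
| "avoid_depth k lam (Suc n) d =
     (if d = 0 then 0
      else (avoid_depth k lam n (d - 1) + real (k d) * lam * avoid_depth k lam n (Suc d))
             / (1 + real (k d) * lam))"

text \<open>This balance between consecutive levels is what makes the partial sums of the
  resistances harmonic for the depth chain away from 0.\<close>

lemma level_resistance_Suc:
  assumes "lam \<noteq> 0" "k (Suc j) \<noteq> 0"
  shows "real (k (Suc j)) * lam * level_resistance k lam (Suc j) = level_resistance k lam j"
  using assms by (simp add: level_resistance_def field_simps)

lemma avoid_depth_0 [simp]: "avoid_depth k lam n 0 = 0"
  by (cases n) auto

locale level_sequence =
  fixes k :: "nat \<Rightarrow> nat" and lam :: real
  assumes k_pos: "\<And>i. 0 < k i" and lam_pos: "0 < lam"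
begin

lemma level_resistance_pos: "0 < level_resistance k lam j"
  using k_pos lam_pos by (auto simp: level_resistance_def intro!: divide_pos_pos mult_pos_pos prod_pos)

lemma suminf_level_resistance_pos:
  "summable (level_resistance k lam) \<Longrightarrow> 0 < suminf (level_resistance k lam)"
  by (rule suminf_pos[OF _ level_resistance_pos])

lemma series_conductance_nonneg: "0 \<le> series_conductance k lam"
  using suminf_level_resistance_pos by (auto simp: series_conductance_def less_imp_le)

lemma denom_pos: "0 < 1 + real (k d) * lam"
  using lam_pos by (intro add_pos_nonneg) auto

lemma avoid_depth_nonneg: "0 \<le> avoid_depth k lam n d"
proof (induction n arbitrary: d)
  case (Suc n)
  then show ?case using lam_pos denom_pos[of d] by (auto intro!: divide_nonneg_pos add_nonneg_nonneg)
qed simp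

text \<open>The recursion is monotone in the previous iterate, and its first step stays below the
  initial value, which is 1 off the origin.\<close>

lemma avoid_depth_antimono: "avoid_depth k lam (Suc n) d \<le> avoid_depth k lam n d"
proof (induction n arbitrary: d)
  case 0
  then show ?case using lam_pos denom_pos[of d] by (auto simp: field_simps)
next
  case (Suc n)
  show ?case
  proof (cases "d = 0")
    case False
    have "avoid_depth k lam (Suc (Suc n)) d = (avoid_depth k lam (Suc n) (d - 1)
        + real (k d) * lam * avoid_depth k lam (Suc n) (Suc d)) / (1 + real (k d) * lam)"
      using False by (subst avoid_depth.simps) simp
    also have "\<dots> \<le> (avoid_depth k lam n (d - 1)
        + real (k d) * lam * avoid_depth k lam n (Suc d)) / (1 + real (k d) * lam)"
      using lam_pos denom_pos[of d]
      by (intro divide_right_mono add_mono mult_left_mono Suc.IH) auto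
    finally show ?thesis using False by simp
  qed simp
qed

lemma decseq_avoid_depth: "decseq (\<lambda>n. avoid_depth k lam n d)"
  by (rule decseq_SucI) (rule avoid_depth_antimono)

definition avoid_limit :: "nat \<Rightarrow> real" where
  "avoid_limit d = lim (\<lambda>n. avoid_depth k lam n d)"

lemma avoid_depth_tendsto: "(\<lambda>n. avoid_depth k lam n d) \<longlonglongrightarrow> avoid_limit d"
proof -
  have "convergent (\<lambda>n. avoid_depth k lam n d)"
    using decseq_convergent[OF decseq_avoid_depth, of 0 d] avoid_depth_nonneg
    by (metis convergentI)
  then show ?thesis by (simp add: avoid_limit_def convergent_LIMSEQ_iff)
qed

lemma avoid_limit_0: "avoid_limit 0 = 0"
  by (simp add: avoid_limit_def)

lemma avoid_limit_le_1: "avoid_limit d \<le> 1"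
  by (rule order_trans[OF decseq_ge[OF decseq_avoid_depth avoid_depth_tendsto, of d 0]]) simp

lemma avoid_limit_nonneg: "0 \<le> avoid_limit d"
  by (rule LIMSEQ_le_const[OF avoid_depth_tendsto]) (simp add: avoid_depth_nonneg)

lemma avoid_limit_harmonic:
  "(1 + real (k (Suc d)) * lam) * avoid_limit (Suc d) =
     avoid_limit d + real (k (Suc d)) * lam * avoid_limit (Suc (Suc d))"
proof -
  have "(\<lambda>n. avoid_depth k lam (Suc n) (Suc d)) \<longlonglongrightarrow>
      (avoid_limit d + real (k (Suc d)) * lam * avoid_limit (Suc (Suc d))) / (1 + real (k (Suc d)) * lam)"
    using denom_pos[of "Suc d"] by (auto intro!: tendsto_intros avoid_depth_tendsto)
  moreover have "(\<lambda>n. avoid_depth k lam (Suc n) (Suc d)) \<longlonglongrightarrow> avoid_limit (Suc d)"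
    by (rule LIMSEQ_Suc[OF avoid_depth_tendsto])
  ultimately have "avoid_limit (Suc d) =
      (avoid_limit d + real (k (Suc d)) * lam * avoid_limit (Suc (Suc d))) / (1 + real (k (Suc d)) * lam)"
    by (rule LIMSEQ_unique[symmetric])
  then show ?thesis
    using denom_pos[of "Suc d"] by (simp add: field_simps)
qed

text \<open>Harmonicity is a first-order recursion for the increments of \<open>avoid_limit\<close>,
  the one that \<open>level_resistance_Suc\<close> gives for the resistances. The increments are
  therefore proportional to the resistances, and summing them starts from the value 0 at depth
  0.\<close>

lemma avoid_limit_eq:
  "avoid_limit d = avoid_limit 1 / level_resistance k lam 0 * (\<Sum>j<d. level_resistance k lam j)"
proof -
  let ?r = "level_resistance k lam"
  have inc: "avoid_limit (Suc d) - avoid_limit d = avoid_limit 1 / ?r 0 * ?r d" for d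
  proof (induction d)
    case 0
    then show ?case using level_resistance_pos[of 0] by (simp add: avoid_limit_0)
  next
    case (Suc d)
    have "real (k (Suc d)) * lam * (avoid_limit (Suc (Suc d)) - avoid_limit (Suc d))
        = avoid_limit (Suc d) - avoid_limit d"
      using avoid_limit_harmonic[of d] by (simp add: algebra_simps)
    also have "\<dots> = avoid_limit 1 / ?r 0 * (real (k (Suc d)) * lam * ?r (Suc d))"
      using Suc.IH level_resistance_Suc[of lam k d] lam_pos k_pos[of "Suc d"] by simp
    also have "\<dots> = real (k (Suc d)) * lam * (avoid_limit 1 / ?r 0 * ?r (Suc d))"
      by (simp add: mult_ac)
    finally show ?case
      using lam_pos k_pos[of "Suc d"] by (subst (asm) mult_left_cancel) simp_all
  qed
  show ?thesis
  proof (induction d)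
    case (Suc d)
    then show ?case using inc[of d] by (simp add: algebra_simps)
  qed (simp add: avoid_limit_0)
qed

text \<open>Comparison principle: the normalised partial sums are harmonic, vanish at 0 and are at
  most 1, so they lie below the initial iterate and each monotone step keeps them below.\<close>

lemma avoid_depth_lower_bound:
  assumes "summable (level_resistance k lam)"
  shows "(\<Sum>j<d. level_resistance k lam j) / suminf (level_resistance k lam) \<le> avoid_depth k lam n d"
proof (induction n arbitrary: d)
  case 0
  have "(\<Sum>j<d. level_resistance k lam j) \<le> suminf (level_resistance k lam)"
    using level_resistance_pos by (intro sum_le_suminf assms) (auto simp: less_imp_le)
  then show ?case
    using suminf_level_resistance_pos[OF assms] by auto
next
  case (Suc n)
  let ?r = "level_resistance k lam" and ?S = "\<lambda>d. (\<Sum>j<d. level_resistance k lam j) / suminf (level_resistance k lam)"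
  show ?case
  proof (cases d)
    case (Suc e)
    have "(1 + real (k d) * lam) * (\<Sum>j<d. ?r j) = (\<Sum>j<e. ?r j) + real (k d) * lam * (\<Sum>j<Suc d. ?r j)"
      using level_resistance_Suc[of lam k e] lam_pos k_pos[of "Suc e"] Suc by (simp add: algebra_simps)
    then have "(1 + real (k d) * lam) * ?S d = ?S e + real (k d) * lam * ?S (Suc d)"
      by (metis (no_types, lifting) add_divide_distrib times_divide_eq_right)
    also have "\<dots> \<le> avoid_depth k lam n e + real (k d) * lam * avoid_depth k lam n (Suc d)"
      using lam_pos by (intro add_mono mult_left_mono Suc.IH) auto
    finally show ?thesis
      using denom_pos[of d] Suc by (simp add: field_simps)
  qed simp
qed

text \<open>The factor \<open>c\<close> of proportionality is pinned from both sides. As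
  \<open>avoid_limit\<close> is at most 1, \<open>c\<close> times any partial sum is at most 1,
  which forces \<open>c = 0\<close> for a divergent series. For a convergent one, the comparison
  principle at depth 1 yields the opposite inequality.\<close>

lemma avoid_limit_1: "avoid_limit 1 = level_resistance k lam 0 * series_conductance k lam"
proof -
  let ?r = "level_resistance k lam"
  define c where "c = avoid_limit 1 / ?r 0"
  have c: "0 \<le> c" and le1: "c * (\<Sum>j<d. ?r j) \<le> 1" for d
    using avoid_limit_nonneg[of 1] level_resistance_pos[of 0] avoid_limit_le_1[of d]
    unfolding c_def avoid_limit_eq[of d] by auto
  have "c = series_conductance k lam"
  proof (cases "summable ?r")
    case True
    have "c * suminf ?r \<le> 1"
      by (rule LIMSEQ_le_const2[OF tendsto_mult_left[OF summable_LIMSEQ[OF True]]]) (simp add: le1)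
    moreover have "?r 0 / suminf ?r \<le> avoid_limit 1"
      using avoid_depth_lower_bound[OF True, of 1]
      by (intro LIMSEQ_le_const[OF avoid_depth_tendsto]) auto
    then have "1 \<le> c * suminf ?r"
      using level_resistance_pos[of 0] suminf_level_resistance_pos[OF True]
      by (simp add: c_def field_simps)
    ultimately have "c * suminf ?r = 1" by simp
    then show ?thesis
      using True suminf_level_resistance_pos[OF True] by (simp add: series_conductance_def field_simps)
  next
    case False
    have "c = 0"
    proof (rule ccontr)
      assume "c \<noteq> 0"
      then have "(\<Sum>j<d. ?r j) \<le> 1 / c" for d
        using c le1[of d] by (simp add: field_simps)
      then have "summable ?r"
        using level_resistance_pos by (intro summableI_nonneg_bounded[where x="1/c"]) (auto simp: less_imp_le)
      with False show False ..
    qed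
    with False show ?thesis by (simp add: series_conductance_def)
  qed
  then show ?thesis
    using level_resistance_pos[of 0] by (simp add: c_def field_simps)
qed

end

section \<open>From the tree to its level sequence\<close>

locale level_tree = level_sequence +
  fixes T :: "vertex set"
  assumes rooted: "rooted_tree T"
    and card_children: "\<And>x. x \<in> T \<Longrightarrow> card (children T x) = k (length x)"
begin

lemma root_in: "[] \<in> T"
  using rooted by (simp add: rooted_tree_def)

lemma children_in: "y \<in> children T x \<Longrightarrow> y \<in> T \<and> length y = Suc (length x)"
  by (cases y rule: rev_cases) (auto simp: children_def)

text \<open>The number of children depends on the depth only, so the walk can be lumped by levels:
  one step maps functions of the depth to functions of the depth.\<close>

lemma nn_integral_RW_step_depth:
  assumes x: "x \<in> T" "x \<noteq> []"
    and f: "\<And>y. y \<in> T \<Longrightarrow> f y = ennreal (g (length y))" and g: "\<And>d. 0 \<le> g d"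
  shows "(\<integral>\<^sup>+y. f y \<partial>measure_pmf (RW_step T lam x)) =
    ennreal ((g (length x - 1) + real (k (length x)) * lam * g (Suc (length x))) / (1 + real (k (length x)) * lam))"
proof -
  let ?C = "children T x" and ?d = "length x" and ?p = "pmf (RW_step T lam x)"
  have p: "?p y = transition_prob T lam x y" for y
    by (rule pmf_RW_step[OF rooted x(1) lam_pos])
  have fin: "finite ?C" by (rule finite_children[OF rooted x(1)])
  have ni: "butlast x \<notin> ?C"
    using children_in[of "butlast x" x] by auto
  have bx: "butlast x \<in> T" using rooted x by (simp add: rooted_tree_def)
  have "(\<integral>\<^sup>+y. f y \<partial>measure_pmf (RW_step T lam x)) = (\<Sum>y\<in>insert (butlast x) ?C. f y * ?p y)"
    using fin x by (intro nn_integral_measure_pmf_support)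
       (auto simp: set_pmf_iff p transition_prob_def Let_def split: if_splits)
  also have "\<dots> = f (butlast x) * ?p (butlast x) + (\<Sum>y\<in>?C. f y * ?p y)"
    using fin ni by simp
  also have "(\<Sum>y\<in>?C. f y * ?p y) = (\<Sum>y\<in>?C. ennreal (g (Suc ?d) * (lam / (1 + real (k ?d) * lam))))"
    using x ni lam_pos g
    by (intro sum.cong refl) (auto simp: f p transition_prob_def Let_def card_children children_in
          simp flip: ennreal_mult)
  also have "\<dots> = ennreal (real (k ?d) * (g (Suc ?d) * (lam / (1 + real (k ?d) * lam))))"
    using lam_pos g by (subst sum_ennreal) (auto simp: card_children x)
  also have "f (butlast x) * ?p (butlast x) = ennreal (g (?d - 1) * (1 / (1 + real (k ?d) * lam)))"
    using x bx lam_pos g by (simp add: f p transition_prob_def Let_def card_children flip: ennreal_mult)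
  also have "ennreal (g (?d - 1) * (1 / (1 + real (k ?d) * lam))) + ennreal (real (k ?d) * (g (Suc ?d) * (lam / (1 + real (k ?d) * lam))))
     = ennreal ((g (?d - 1) + real (k ?d) * lam * g (Suc ?d)) / (1 + real (k ?d) * lam))"
    using lam_pos g by (subst ennreal_plus[symmetric]) (auto simp: add_divide_distrib mult_ac)
  finally show ?thesis .
qed

lemma avoid_prob_eq: "x \<in> T \<Longrightarrow> avoid_prob T lam n x = ennreal (avoid_depth k lam n (length x))"
proof (induction n arbitrary: x)
  case (Suc n)
  show ?case
  proof (cases "x = []")
    case False
    with nn_integral_RW_step_depth[OF Suc.prems False, of "avoid_prob T lam n" "avoid_depth k lam n"]
    show ?thesis by (simp add: Suc.IH avoid_depth_nonneg)
  qed simp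
qed simp

text \<open>The first step is treated apart: it leads to depth 1 almost surely, whereas
  \<open>avoid_depth\<close> treats depth 0 as absorbing with value 0.\<close>

lemma nn_integral_RW_step_root:
  "(\<integral>\<^sup>+y. avoid_prob T lam n y \<partial>measure_pmf (RW_step T lam [])) = ennreal (avoid_depth k lam n 1)"
proof -
  have p: "pmf (RW_step T lam []) y = transition_prob T lam [] y" for y
    by (rule pmf_RW_step[OF rooted root_in lam_pos])
  have "AE y in measure_pmf (RW_step T lam []). avoid_prob T lam n y = ennreal (avoid_depth k lam n 1)"
    using children_in[of _ "[]"]
    by (auto simp: AE_measure_pmf_iff set_pmf_iff p transition_prob_def avoid_prob_eq Let_def split: if_splits)
  then have "(\<integral>\<^sup>+y. avoid_prob T lam n y \<partial>measure_pmf (RW_step T lam [])) =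
     (\<integral>\<^sup>+y. ennreal (avoid_depth k lam n 1) \<partial>measure_pmf (RW_step T lam []))"
    by (rule nn_integral_cong_AE)
  then show ?thesis by simp
qed

lemma neighbours_root: "neighbours T [] = children T []"
  using root_in by (auto simp: neighbours_def children_def)

text \<open>Continuity from above: the escape event is the decreasing intersection of the
  finite-time events.\<close>

lemma measure_RW_escape:
  "measure (RW T lam) {\<omega>. \<forall>n>0. \<omega> n \<noteq> []} = avoid_limit 1"
proof -
  interpret R: prob_space "RW T lam" by (rule prob_space_RW)
  let ?E = "\<lambda>n. {\<omega>. \<forall>i\<in>{0<..Suc n}. \<omega> i \<noteq> []} :: (nat \<Rightarrow> vertex) set"
  have em: "emeasure (RW T lam) (?E n) = ennreal (avoid_depth k lam n 1)" for n
    by (simp only: emeasure_RW_avoid nn_integral_RW_step_root)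
  have m: "measure (RW T lam) (?E n) = avoid_depth k lam n 1" for n
    using em[of n] avoid_depth_nonneg by (simp add: measure_def)
  have sets: "?E n \<in> sets (RW T lam)" for n
  proof -
    have [measurable]: "(\<lambda>\<omega>. \<omega> i) \<in> measurable (PiM UNIV (\<lambda>_. count_space UNIV :: vertex measure)) (count_space UNIV)" for i :: nat
      by (intro measurable_component_singleton) auto
    have "{\<omega> \<in> space (RW T lam). \<forall>i\<in>{0<..Suc n}. \<omega> i \<noteq> []} \<in> sets (RW T lam)"
      by (intro predE pred_intros_finite) auto
    then show ?thesis by (simp add: space_RW)
  qed
  have "(\<lambda>n. measure (RW T lam) (?E n)) \<longlonglongrightarrow> measure (RW T lam) (\<Inter>n. ?E n)"
    using sets by (intro R.finite_Lim_measure_decseq) (auto simp: decseq_def)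
  moreover have "(\<Inter>n. ?E n) = {\<omega>. \<forall>n>0. \<omega> n \<noteq> []}"
    by (auto simp: Suc_le_eq)
       (metis greaterThanAtMost_iff lessI less_imp_le_nat)
  ultimately show ?thesis
    using LIMSEQ_unique[OF avoid_depth_tendsto] by (simp add: m)
qed

text \<open>The edges at the root have conductance 1, so the total conductance there is
  \<open>k 0\<close>, which cancels the factor \<open>level_resistance k lam 0\<close> in
  \<open>avoid_limit_1\<close>.\<close>

lemma effective_conductance_eq: "effective_conductance lam T = series_conductance k lam"
proof -
  have "total_conductance T lam [] = real (k 0)"
    using card_children[OF root_in] by (simp add: total_conductance_def neighbours_root conductance_def)
  moreover have "level_resistance k lam 0 = 1 / real (k 0)"
    by (simp add: level_resistance_def)
  ultimately show ?thesis
    using k_pos[of 0] avoid_limit_1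
    by (simp add: effective_conductance_def space_RW measure_RW_escape)
qed

end

section \<open>Trees of bounded degree and admissible level sequences\<close>

definition admissible :: "nat \<Rightarrow> (nat \<Rightarrow> nat) \<Rightarrow> bool" where
  "admissible m k \<longleftrightarrow> (\<forall>i. 0 < k i \<and> k i + of_bool (i \<noteq> 0) \<le> m)"

text \<open>The extra neighbour is the parent, which the root lacks; this explains the
  \<open>of_bool\<close> term in \<open>admissible\<close>.\<close>

lemma deg_eq:
  assumes "rooted_tree T" "x \<in> T"
  shows "deg T x = card (children T x) + of_bool (x \<noteq> [])"
proof -
  have "neighbours T x = children T x \<union> (if x = [] then {} else {butlast x})"
    using assms by (auto simp: neighbours_def children_def rooted_tree_def)
  moreover have "butlast x \<notin> children T x" if "x \<noteq> []"
    using that by (cases x rule: rev_cases) (auto simp: children_def dest: arg_cong[where f=length])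
  ultimately show ?thesis
    using finite_children[OF assms] by (auto simp: deg_def)
qed

lemma finite_level:
  assumes "rooted_tree T"
  shows "finite {x \<in> T. length x = n}"
proof (induction n)
  case (Suc n)
  have "{x \<in> T. length x = Suc n} \<subseteq> (\<Union>x\<in>{x \<in> T. length x = n}. children T x)"
  proof
    fix x assume x: "x \<in> {x \<in> T. length x = Suc n}"
    then have "x \<noteq> []" "butlast x \<in> T" using assms by (auto simp: rooted_tree_def)
    with x show "x \<in> (\<Union>x\<in>{x \<in> T. length x = n}. children T x)"
      by (intro UN_I[of "butlast x"]) (auto simp: children_def)
  qed
  moreover have "finite (\<Union>x\<in>{x \<in> T. length x = n}. children T x)"
    using Suc.IH finite_children[OF assms] by auto
  ultimately show ?case by (rule finite_subset)
qed (auto intro: finite_subset[of _ "{[]}"])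

text \<open>A tree is closed under prefixes, so an empty level leaves all deeper levels empty, and
  finitely many finite levels cannot make up an infinite tree.\<close>

lemma level_nonempty:
  assumes T: "rooted_tree T"
  shows "\<exists>x\<in>T. length x = n"
proof (rule ccontr)
  assume *: "\<not> ?thesis"
  have "length x < n" if "x \<in> T" for x
    using that
  proof (induction x rule: rev_induct)
    case Nil
    with * show ?case by (cases n) auto
  next
    case (snoc a x)
    then have "x \<in> T" using T unfolding rooted_tree_def by force
    with snoc have "length (x @ [a]) \<le> n" by simp
    with * snoc.prems show ?case by (metis le_neq_implies_less)
  qed
  then have "T \<subseteq> (\<Union>i<n. {x \<in> T. length x = i})" by auto
  then have "finite T"
    by (rule finite_subset) (auto intro: finite_level[OF T])
  with T show False by (simp add: rooted_tree_def)
qed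

lemma A_trees_level_sequence:
  assumes "T \<in> A_trees m"
  obtains k where "admissible m k" "\<And>x. x \<in> T \<Longrightarrow> card (children T x) = k (length x)"
proof -
  have T: "rooted_tree T" and sym: "spherically_symmetric T" and deg: "\<And>x. x \<in> T \<Longrightarrow> deg T x \<le> m"
    using assms by (auto simp: A_trees_def)
  have "\<exists>v. \<forall>n. v n \<in> T \<and> length (v n) = n"
    using level_nonempty[OF T] by metis
  then obtain v where v: "\<And>n. v n \<in> T" "\<And>n. length (v n) = n" by blast
  define k where "k n = card (children T (v n))" for n
  have card: "card (children T x) = k (length x)" if "x \<in> T" for x
  proof -
    have "deg T x = deg T (v (length x))"
      using sym[unfolded spherically_symmetric_def, rule_format, OF that v(1)] v(2) by metis
    moreover have "x = [] \<longleftrightarrow> v (length x) = []" by (simp add: v(2) flip: length_0_conv)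
    ultimately show ?thesis
      using that v by (simp add: deg_eq[OF T] k_def)
  qed
  \<comment> \<open>A vertex at depth \<open>n + 1\<close> has a parent with at least one child, and
    by symmetry the count is the same on the whole level \<open>n\<close>.\<close>
  have "0 < k n" for n
  proof -
    obtain y where y: "y \<in> T" "length y = Suc n" using level_nonempty[OF T] by blast
    then have b: "butlast y \<in> T" "y \<in> children T (butlast y)"
      using T by (auto simp: rooted_tree_def children_def)
    with finite_children[OF T] have "0 < card (children T (butlast y))"
      by (auto simp: card_gt_0_iff)
    with card[OF b(1)] y show ?thesis by simp
  qed
  moreover have "k n + of_bool (n \<noteq> 0) \<le> m" for n
  proof -
    have "v n = [] \<longleftrightarrow> n = 0" by (simp add: v(2) flip: length_0_conv)
    with deg[OF v(1), of n] v deg_eq[OF T v(1), of n] show ?thesis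
      by (simp add: k_def)
  qed
  ultimately show ?thesis
    using card by (intro that[of k]) (auto simp: admissible_def)
qed

text \<open>Entry \<open>i\<close> of a vertex selects one of the \<open>k i\<close> children of its
  prefix of length \<open>i\<close>. This realises a prescribed sequence by a tree.\<close>

definition sequence_tree :: "(nat \<Rightarrow> nat) \<Rightarrow> vertex set" where
  "sequence_tree k = {x. \<forall>i<length x. x ! i < k i}"

lemma sequence_tree_snoc [simp]:
  "x @ [a] \<in> sequence_tree k \<longleftrightarrow> x \<in> sequence_tree k \<and> a < k (length x)"
  by (auto simp: sequence_tree_def nth_append less_Suc_eq)

lemma children_sequence_tree:
  assumes "x \<in> sequence_tree k"
  shows "children (sequence_tree k) x = (\<lambda>a. x @ [a]) ` {..<k (length x)}"
proof (intro equalityI subsetI)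
  fix y assume "y \<in> children (sequence_tree k) x"
  then show "y \<in> (\<lambda>a. x @ [a]) ` {..<k (length x)}"
    by (cases y rule: rev_cases) (auto simp: children_def)
qed (use assms in \<open>auto simp: children_def\<close>)

lemma card_children_sequence_tree:
  "x \<in> sequence_tree k \<Longrightarrow> card (children (sequence_tree k) x) = k (length x)"
  by (simp add: children_sequence_tree card_image inj_on_def)

lemma rooted_tree_sequence_tree:
  assumes "\<And>i. 0 < k i"
  shows "rooted_tree (sequence_tree k)"
  unfolding rooted_tree_def
proof (intro conjI ballI impI)
  show "[] \<in> sequence_tree k" by (simp add: sequence_tree_def)
  have *: "butlast x \<in> sequence_tree k" if "x \<in> sequence_tree k" for x
    using that by (cases x rule: rev_cases) auto
  then show "butlast x \<in> sequence_tree k" if "x \<in> sequence_tree k" for x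
    using that .
  show "finite (neighbours (sequence_tree k) x)" if "x \<in> sequence_tree k" for x
  proof (rule finite_subset)
    show "neighbours (sequence_tree k) x \<subseteq> children (sequence_tree k) x \<union> {butlast x}"
      by (auto simp: neighbours_def children_def)
    show "finite (children (sequence_tree k) x \<union> {butlast x})"
      using that by (simp add: children_sequence_tree)
  qed
  \<comment> \<open>The words of zeros form an infinite ray, as label 0 is always allowed.\<close>
  have "range (\<lambda>n. replicate n 0) \<subseteq> sequence_tree k"
    using assms by (auto simp: sequence_tree_def)
  moreover have "inj (\<lambda>n. replicate n (0::nat))"
    by (auto simp: inj_on_def)
  ultimately show "infinite (sequence_tree k)"
    using range_inj_infinite infinite_super by blast
qed

lemma sequence_tree_in_A_trees:
  assumes "admissible m k"
  shows "sequence_tree k \<in> A_trees m"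
proof -
  have T: "rooted_tree (sequence_tree k)"
    using assms by (intro rooted_tree_sequence_tree) (auto simp: admissible_def)
  have deg: "deg (sequence_tree k) x = k (length x) + of_bool (length x \<noteq> 0)" if "x \<in> sequence_tree k" for x
    using that by (simp add: deg_eq[OF T] card_children_sequence_tree)
  show ?thesis
    using T assms unfolding A_trees_def spherically_symmetric_def admissible_def
    by (simp add: deg del: length_0_conv length_greater_0_conv)
qed

text \<open>From here on trees and walks are replaced by level sequences and their resistance
  series.\<close>

lemma F_functions_iff:
  "f \<in> F_functions m \<longleftrightarrow> continuous_on {0..1} f \<and>
     (\<exists>k. admissible m k \<and> (\<forall>lam\<in>{0<..1}. f lam = series_conductance k lam))"
proof -
  have eq: "effective_conductance lam T = series_conductance k lam"
    if "admissible m k" "T \<in> A_trees m" "\<And>x. x \<in> T \<Longrightarrow> card (children T x) = k (length x)" "lam \<in> {0<..1}"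
    for T k lam
  proof -
    interpret level_tree k lam T
      using that by unfold_locales (auto simp: admissible_def A_trees_def)
    show ?thesis by (rule effective_conductance_eq)
  qed
  have "(\<exists>T\<in>A_trees m. \<forall>lam\<in>{0<..1}. f lam = effective_conductance lam T) \<longleftrightarrow>
      (\<exists>k. admissible m k \<and> (\<forall>lam\<in>{0<..1}. f lam = series_conductance k lam))" (is "?L \<longleftrightarrow> ?R")
  proof
    assume ?L
    then obtain T where T: "T \<in> A_trees m" "\<forall>lam\<in>{0<..1}. f lam = effective_conductance lam T" by blast
    from T(1) obtain k where "admissible m k" "\<And>x. x \<in> T \<Longrightarrow> card (children T x) = k (length x)"
      by (rule A_trees_level_sequence) blast
    with T eq show ?R by metis
  next
    assume ?R
    then obtain k where "admissible m k" "\<forall>lam\<in>{0<..1}. f lam = series_conductance k lam" by blast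
    with eq[of k "sequence_tree k"] show ?L
      by (intro bexI[of _ "sequence_tree k"]) (auto simp: card_children_sequence_tree sequence_tree_in_A_trees)
  qed
  then show ?thesis by (simp add: F_functions_def)
qed

section \<open>Limits of conductances\<close>

lemma admissible_subsequence:
  fixes ks :: "nat \<Rightarrow> nat \<Rightarrow> nat"
  assumes "\<And>n. admissible m (ks n)"
  obtains l r where "strict_mono r" "admissible m l" "\<And>i. \<forall>\<^sub>F n in sequentially. ks (r n) i = l i"
proof -
  \<comment> \<open>By Tychonoff this product of finite sets is compact, and sequential compactness
    supplies the subsequence.\<close>
  define K where "K = PiE (UNIV::nat set) (\<lambda>_. {..m})"
  have "compact K"
    using compactin_PiE[of "\<lambda>_::nat. euclidean :: nat topology" UNIV "\<lambda>_. {..m}"]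
    by (simp add: K_def euclidean_product_topology finite_imp_compact)
  then have "seq_compact K" by (rule compact_imp_seq_compact)
  moreover have "ks n i \<le> m" for n i
    using assms[of n] unfolding admissible_def by (meson add_leD1)
  then have "\<forall>n. ks n \<in> K"
    by (simp add: K_def PiE_UNIV_domain)
  ultimately obtain l r where "l \<in> K" and r: "strict_mono r" "(ks \<circ> r) \<longlonglongrightarrow> l"
    by (rule seq_compactE)
  \<comment> \<open>Convergence in a discrete space means eventual equality.\<close>
  have ev: "\<forall>\<^sub>F n in sequentially. ks (r n) i = l i" for i
  proof -
    have "(\<lambda>n. (ks \<circ> r) n i) \<longlonglongrightarrow> l i"
      by (rule continuous_on_tendsto_compose[OF continuous_on_product_coordinates r(2)]) auto
    then show ?thesis by (simp add: tendsto_discrete)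
  qed
  have "0 < l i \<and> l i + of_bool (i \<noteq> 0) \<le> m" for i
  proof -
    obtain n where "ks (r n) i = l i"
      using eventually_happens'[OF sequentially_bot ev[of i]] by blast
    with assms[of "r n"] show ?thesis unfolding admissible_def by metis
  qed
  then have "admissible m l" by (simp add: admissible_def)
  then show ?thesis by (rule that[OF r(1) _ ev])
qed

text \<open>For \<open>lam > lam0\<close> the geometric factor turns a mere bound on the resistances
  at \<open>lam0\<close> into a summable majorant at \<open>lam\<close>.\<close>

lemma level_resistance_scale:
  assumes "0 < lam0" "0 < lam"
  shows "level_resistance k lam j = level_resistance k lam0 j * (lam0 / lam) ^ j"
  using assms by (simp add: level_resistance_def power_divide)

lemma level_resistance_antimono:
  assumes "\<And>i. 0 < k i" "0 < lam0" "lam0 \<le> lam"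
  shows "level_resistance k lam j \<le> level_resistance k lam0 j"
proof -
  interpret level_sequence k lam0 using assms by unfold_locales
  have "(lam0 / lam) ^ j \<le> 1" using assms by (intro power_le_one) auto
  then show ?thesis
    using level_resistance_scale[of lam0 lam k j] assms level_resistance_pos[of j]
    by (simp add: mult_left_le)
qed

lemma series_conductance_mono:
  assumes k: "\<And>i. 0 < k i" and lam: "0 < lam0" "lam0 \<le> lam"
  shows "series_conductance k lam0 \<le> series_conductance k lam"
proof -
  interpret L0: level_sequence k lam0 using assms by unfold_locales
  interpret L: level_sequence k lam using assms by unfold_locales auto
  show ?thesis
  proof (cases "summable (level_resistance k lam0)")
    case True
    have le: "level_resistance k lam j \<le> level_resistance k lam0 j" for j
      by (rule level_resistance_antimono[OF assms])
    have s: "summable (level_resistance k lam)"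
      using L.level_resistance_pos le
      by (intro summable_comparison_test'[OF True, of 0]) (auto simp: abs_of_pos)
    have "suminf (level_resistance k lam) \<le> suminf (level_resistance k lam0)"
      by (rule suminf_le[OF le s True])
    then show ?thesis
      using True s L.suminf_level_resistance_pos[OF s] by (simp add: series_conductance_def frac_le)
  next
    case False
    then show ?thesis using L.series_conductance_nonneg by (simp add: series_conductance_def[of k lam0])
  qed
qed

text \<open>Dominated convergence for series (Tannery). Conductance at least \<delta> at
  \<open>lam0\<close> bounds the total resistance there, hence each single one, by 1 / \<delta>;
  rescaling to \<open>lam\<close> gives the geometric majorant \<open>?M\<close>, the same for all
  large \<open>n\<close>.\<close>

lemma series_conductance_tendsto:
  assumes ks: "\<And>n i. 0 < ks n i" and l: "\<And>i. 0 < l i"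
    and ev: "\<And>i. \<forall>\<^sub>F n in sequentially. ks n i = l i"
    and lam: "0 < lam0" "lam0 < lam" and \<delta>: "0 < \<delta>"
    and bound: "\<forall>\<^sub>F n in sequentially. \<delta> \<le> series_conductance (ks n) lam0"
  shows "(\<lambda>n. series_conductance (ks n) lam) \<longlonglongrightarrow> series_conductance l lam"
proof -
  let ?M = "\<lambda>j. 1 / \<delta> * (lam0 / lam) ^ j"
  \<comment> \<open>The \<open>j\<close>-th resistance involves the entries \<open>0, ..., j\<close>
    only, so it is eventually constant in \<open>n\<close>.\<close>
  have lim: "(\<lambda>n. level_resistance (ks n) lam j) \<longlonglongrightarrow> level_resistance l lam j" for j
  proof (rule tendsto_eventually)
    have "\<forall>\<^sub>F n in sequentially. \<forall>i\<in>{..j}. ks n i = l i"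
      by (intro eventually_ball_finite) (auto intro: ev)
    then show "\<forall>\<^sub>F n in sequentially. level_resistance (ks n) lam j = level_resistance l lam j"
      by eventually_elim (simp add: level_resistance_def)
  qed
  have dom: "\<forall>\<^sub>F n in sequentially. \<forall>j. norm (level_resistance (ks n) lam j) \<le> ?M j"
    using bound
  proof eventually_elim
    case (elim n)
    interpret L0: level_sequence "ks n" lam0 using ks lam by unfold_locales
    interpret L: level_sequence "ks n" lam using ks lam by unfold_locales auto
    have s: "summable (level_resistance (ks n) lam0)"
      using elim \<delta> by (auto simp: series_conductance_def split: if_splits)
    have "suminf (level_resistance (ks n) lam0) \<le> 1 / \<delta>"
      using elim \<delta> s L0.suminf_level_resistance_pos[OF s] by (simp add: series_conductance_def field_simps)
    moreover have "level_resistance (ks n) lam0 j \<le> suminf (level_resistance (ks n) lam0)" for j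
      using sum_le_suminf[OF s, of "{j}"] L0.level_resistance_pos by (auto simp: less_imp_le)
    ultimately have "level_resistance (ks n) lam0 j \<le> 1 / \<delta>" for j
      by (meson order_trans)
    then have "level_resistance (ks n) lam0 j * (lam0 / lam) ^ j \<le> ?M j" for j
      using lam by (intro mult_right_mono) auto
    then show ?case
      using level_resistance_scale[of lam0 lam "ks n"] lam L.level_resistance_pos by (simp add: abs_of_pos)
  qed
  have dom': "\<forall>\<^sub>F (j, n) in at_top \<times>\<^sub>F sequentially. norm (level_resistance (ks n) lam j) \<le> ?M j"
    by (rule eventually_mono[OF eventually_compose_filterlim[OF dom filterlim_snd]]) auto
  have "summable ?M"
    using lam by (intro summable_mult summable_geometric) auto
  note tannery = tannerys_theorem[OF lim dom' this sequentially_bot]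
  interpret L: level_sequence l lam using l lam by unfold_locales auto
  have s: "summable (level_resistance l lam)"
    using tannery summable_norm_cancel by blast
  have "\<forall>\<^sub>F n in sequentially. summable (level_resistance (ks n) lam)"
    using tannery by (auto elim!: eventually_mono intro: summable_norm_cancel)
  then have "\<forall>\<^sub>F n in sequentially. 1 / suminf (level_resistance (ks n) lam) = series_conductance (ks n) lam"
    by eventually_elim (simp add: series_conductance_def)
  moreover have "(\<lambda>n. 1 / suminf (level_resistance (ks n) lam)) \<longlonglongrightarrow> 1 / suminf (level_resistance l lam)"
    using tannery L.suminf_level_resistance_pos[OF s] by (intro tendsto_intros) auto
  ultimately show ?thesis
    using s by (simp add: series_conductance_def[of l] filterlim_cong[OF refl refl])
qed

section \<open>Identification of the limit function\<close>

lemma limit_eq_series_conductance: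
  assumes ks: "\<And>n i. 0 < ks n i" and l: "\<And>i. 0 < l i"
    and ev: "\<And>i. \<forall>\<^sub>F n in sequentially. ks n i = l i"
    and conv: "\<And>x. x \<in> {0<..1} \<Longrightarrow> (\<lambda>n. series_conductance (ks n) x) \<longlonglongrightarrow> g x"
    and cont: "continuous_on {0..1} g" and nz: "\<exists>x\<in>{0..1}. g x \<noteq> 0"
    and lam: "lam \<in> {0<..1}"
  shows "g lam = series_conductance l lam"
proof -
  have nonneg: "0 \<le> g x" if x: "x \<in> {0<..1}" for x
  proof (rule LIMSEQ_le_const[OF conv[OF x]])
    have "level_sequence (ks n) x" for n using ks x by unfold_locales auto
    then show "\<exists>N. \<forall>n\<ge>N. 0 \<le> series_conductance (ks n) x"
      by (auto intro: level_sequence.series_conductance_nonneg)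
  qed
  \<comment> \<open>Convergence at \<open>x\<close> to a positive value makes \<open>g x / 2\<close>
    an eventual lower bound, as domination at \<open>y > x\<close> requires.\<close>
  have eq: "g y = series_conductance l y" if "0 < x" "x < y" "y \<le> 1" "0 < g x" for x y
  proof (rule LIMSEQ_unique[OF conv])
    have "\<forall>\<^sub>F n in sequentially. g x / 2 < series_conductance (ks n) x"
      using that by (intro order_tendstoD[OF conv]) auto
    then have "\<forall>\<^sub>F n in sequentially. g x / 2 \<le> series_conductance (ks n) x"
      by (auto elim: eventually_mono)
    then show "(\<lambda>n. series_conductance (ks n) y) \<longlonglongrightarrow> series_conductance l y"
      using that by (intro series_conductance_tendsto[OF ks l ev, of x y "g x / 2"]) auto
  qed (use that in auto)
  \<comment> \<open>Continuity carries the zeros of \<open>g\<close> from an open interval to its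
    endpoints; this covers the points 0, 1 and \<open>s\<close>.\<close>
  have vanish: "g w = 0" if "x < y" "0 \<le> x" "y \<le> 1" "\<And>z. z \<in> {x<..<y} \<Longrightarrow> g z = 0" "w \<in> {x..y}" for x y w
  proof (rule continuous_constant_on_closure[where f = g and S = "{x<..<y}"])
    show "continuous_on (closure {x<..<y}) g"
      using that by (intro continuous_on_subset[OF cont]) auto
  qed (use that in auto)
  define P where "P = {x \<in> {0<..<1}. 0 < g x}"
  show ?thesis
  proof (cases "\<exists>x\<in>{0<..<lam}. 0 < g x")
    case True
    with eq lam show ?thesis by auto
  next
    case False
    define s where "s = Inf P"
    have zero: "g z = 0" if "z \<in> {0<..<1}" "z \<notin> P" for z
      using that nonneg[of z] by (auto simp: P_def)
    \<comment> \<open>Otherwise \<open>g\<close> vanishes on the open unit interval, hence on the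
      closed one.\<close>
    have P: "P \<noteq> {}"
    proof
      assume "P = {}"
      with vanish[of 0 1] zero have "g x = 0" if "x \<in> {0..1}" for x using that by simp
      with nz show False by simp
    qed
    have bdd: "bdd_below P"
      by (rule bdd_belowI[of _ 0]) (auto simp: P_def)
    have "s < 1"
    proof -
      obtain p where "p \<in> P" using P by blast
      with cInf_lower[OF this bdd] show ?thesis by (simp add: P_def s_def)
    qed
    have "lam \<le> s"
      unfolding s_def
    proof (rule cInf_greatest[OF P])
      fix p assume "p \<in> P"
      with False show "lam \<le> p" by (cases "lam \<le> p") (auto simp: P_def)
    qed
    have below: "g z = 0" if "z \<in> {0<..<s}" for z
    proof (rule zero)
      show "z \<in> {0<..<1}" using that \<open>s < 1\<close> by simp
      show "z \<notin> P" using that cInf_lower[OF _ bdd, of z] by (auto simp: s_def)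
    qed
    have g0: "g z = 0" if "z \<in> {0<..s}" for z
      by (rule vanish[of 0 s, OF _ _ _ below]) (use that \<open>s < 1\<close> in auto)
    \<comment> \<open>Every \<open>y\<close> in \<open>(s, 1)\<close> has a point of
      \<open>P\<close> below it, so there \<open>g y\<close> is the conductance of \<open>l\<close>
      at \<open>y\<close>, at least the one at \<open>lam\<close> by monotonicity. Letting
      \<open>y\<close> decrease to \<open>s\<close> gives the bound at \<open>s\<close>, and
      \<open>g s = 0\<close>.\<close>
    have "series_conductance l lam \<le> g s"
    proof (rule continuous_ge_on_closure[where f = g and S = "{s<..<1}"])
      show "continuous_on (closure {s<..<1}) g"
        using \<open>s < 1\<close> lam \<open>lam \<le> s\<close> by (intro continuous_on_subset[OF cont]) auto
      show "s \<in> closure {s<..<1}"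
        using \<open>s < 1\<close> by simp
      fix y assume y: "y \<in> {s<..<1}"
      then obtain x where "x \<in> P" "x < y"
        using P cInf_lessD[of P y] by (auto simp: s_def)
      then have "g y = series_conductance l y"
        using y by (intro eq[of x]) (auto simp: P_def)
      then show "series_conductance l lam \<le> g y"
        using y lam \<open>lam \<le> s\<close> by (simp add: series_conductance_mono[OF l])
    qed
    then show ?thesis
      using level_sequence.series_conductance_nonneg[of l lam] level_sequence.intro[of l lam] l g0[of s] g0[of lam] lam \<open>lam \<le> s\<close> by auto
  qed
qed

theorem theorem4:
  fixes m :: nat and f :: "nat \<Rightarrow> real \<Rightarrow> real" and g :: "real \<Rightarrow> real"
  assumes "m \<ge> 1"
    and "\<And>n. f n \<in> F_functions m"
    and "uniform_limit {0..1} f g sequentially"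
    and "\<exists>x\<in>{0..1}. g x \<noteq> 0"
  shows "g \<in> F_functions m"
proof -
  have "\<exists>ks. \<forall>n. admissible m (ks n) \<and> (\<forall>lam\<in>{0<..1}. f n lam = series_conductance (ks n) lam)"
    using assms(2) unfolding F_functions_iff by metis
  then obtain ks where ks: "\<And>n. admissible m (ks n)"
      "\<And>n lam. lam \<in> {0<..1} \<Longrightarrow> f n lam = series_conductance (ks n) lam"
    by blast
  obtain l r where r: "strict_mono r" and l: "admissible m l"
      and ev: "\<And>i. \<forall>\<^sub>F n in sequentially. ks (r n) i = l i"
    by (rule admissible_subsequence[of m ks, OF ks(1)]) (rule that)
  have cont: "continuous_on {0..1} g"
    using assms(2,3) by (intro uniform_limit_theorem[OF _ assms(3)]) (auto simp: F_functions_def)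
  have conv: "(\<lambda>n. series_conductance (ks (r n)) x) \<longlonglongrightarrow> g x" if "x \<in> {0<..1}" for x
  proof -
    have "(\<lambda>n. f n x) \<longlonglongrightarrow> g x"
      using that by (intro tendsto_uniform_limitI[OF assms(3)]) auto
    from LIMSEQ_subseq_LIMSEQ[OF this r] show ?thesis
      using that by (simp add: comp_def ks(2))
  qed
  have "g lam = series_conductance l lam" if "lam \<in> {0<..1}" for lam
    by (rule limit_eq_series_conductance[OF _ _ ev conv cont assms(4) that])
       (use ks(1) l in \<open>auto simp: admissible_def\<close>)
  with cont l show ?thesis by (auto simp: F_functions_iff)
qed

end
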